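(* Let $k\ge 1$ and $N\ge 1$ be integers. Then $$T^k(N)=\lim_{n\to+\infty}\left(\frac{1}{2(n+1)}\sum_{j=0}^{n}\Big(F_j^k(N+A_j)+F_{-j-1}^k(N+A_{-j-1})\Big)\right).$$
   Context: The Collatz function $T$ is defined on positive integers by $T(N)=\frac{N}{2}$ if $N$ is even and $T(N)=\frac{3}{2}N+\frac12$ if $N$ is odd. For $n\in\mathbb{Z}$, put $A_n=2n+1$ and $D(n)=\{P\in\mathbb{Z} : P\ge 2n+2\}$. The function $F_n$ is defined on $D(n)$, with integer values, by $F_n(P)=\frac{3}{2}P-n$ if $P$ is even, and $F_n(P)=\frac{P}{2}+\frac{2n+1}{2}$ if $P$ is odd (the formula makes sense for every integer $P$, and iterates are computed by applying it repeatedly). $T^k$ and $F_n^k$ denote $k$-fold iterates. *)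

theory Defs
  imports Complex_Main
begin

text \<open>The parity conditions make every division below exact, see the lemmas
  \<open>real_collatz_T\<close> and \<open>real_F\<close>. The argument \<open>0\<close> is outside the domain of
  the Collatz function; its value there is irrelevant.\<close>

definition collatz_T :: "nat \<Rightarrow> nat" where
  "collatz_T N = (if even N then N div 2 else (3 * N + 1) div 2)"

definition A :: "int \<Rightarrow> int" where
  "A n = 2 * n + 1"

definition D :: "int \<Rightarrow> int set" where
  "D n = {P. P \<ge> 2 * n + 2}"

text \<open>\<open>F n\<close> is given by its formula on all integers; it restricts to a self-map
  of \<open>D n\<close> (lemma \<open>F_in_D\<close>).\<close>

definition F :: "int \<Rightarrow> int \<Rightarrow> int" where
  "F n P = (if even P then (3 * P) div 2 - n else (P + (2 * n + 1)) div 2)"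

lemma real_collatz_T:
  "real (collatz_T N) = (if even N then real N / 2 else 3 / 2 * real N + 1 / 2)"
proof (cases "even N")
  case True
  then obtain m where "N = 2 * m" by (elim evenE)
  then show ?thesis by (simp add: collatz_T_def)
next
  case False
  then obtain m where m: "N = 2 * m + 1" by (elim oddE)
  then have "3 * N + 1 = 2 * (3 * m + 2)" by simp
  then have "collatz_T N = 3 * m + 2" using False unfolding collatz_T_def
    by (metis nonzero_mult_div_cancel_left zero_neq_numeral)
  then show ?thesis using m by (simp add: field_simps)
qed

lemma collatz_T_pos: "N \<ge> 1 \<Longrightarrow> collatz_T N \<ge> 1"
  unfolding collatz_T_def by presburger

lemma real_F:
  "real_of_int (F n P) =
    (if even P then 3 / 2 * real_of_int P - real_of_int n
     else real_of_int P / 2 + (2 * real_of_int n + 1) / 2)"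
proof (cases "even P")
  case True
  then obtain m where "P = 2 * m" by (elim evenE)
  then show ?thesis by (simp add: F_def)
next
  case False
  then obtain m where m: "P = 2 * m + 1" by (elim oddE)
  have "F n P = m + n + 1" using m by (simp add: F_def)
  then show ?thesis using m by (simp add: field_simps)
qed

lemma F_in_D: "P \<in> D n \<Longrightarrow> F n P \<in> D n"
  unfolding D_def F_def mem_Collect_eq by presburger

lemma shift_in_D: "N \<ge> 1 \<Longrightarrow> N + A n \<in> D n"
  by (simp add: D_def A_def)

end

(* Translation by A n conjugates F n to the Collatz map on the integers, so
   F_n^k(N + A_n) = T^k(N) + A_n. Since A_j + A_(-j-1) = 0, every summand equals 2 T^k(N), and
   the sequence of averages is constant. *)
theory Submission
  imports Defs
begin

text \<open>Since \<open>A n\<close> is odd, the shift flips parity and swaps the branches: for even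
  \<open>N\<close>, (N + 2(2n+1))/2 = N/2 + (2n+1); for odd \<open>N\<close>, 3(N + 2n+1)/2 - n =
  (3N+1)/2 + (2n+1).\<close>

lemma F_shift: "F n (int N + A n) = int (collatz_T N) + A n"
  unfolding F_def A_def collatz_T_def by presburger

lemma F_funpow_shift: "(F n ^^ k) (int N + A n) = int ((collatz_T ^^ k) N) + A n"
  by (induction k) (simp_all add: F_shift)

theorem theorem2p2:
  fixes k N :: nat
  assumes "k \<ge> 1" and "N \<ge> 1"
  shows "(\<lambda>n::nat. 1 / (2 * (real n + 1)) *
            (\<Sum>j=0..n. real_of_int
               ((F (int j) ^^ k) (int N + A (int j))
                + (F (- int j - 1) ^^ k) (int N + A (- int j - 1)))))
         \<longlonglongrightarrow> real ((collatz_T ^^ k) N)"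
proof -
  \<comment> \<open>The shift identity holds for negative indices too, so it covers both
    terms.\<close>
  have summand: "(F (int j) ^^ k) (int N + A (int j))
      + (F (- int j - 1) ^^ k) (int N + A (- int j - 1)) = 2 * int ((collatz_T ^^ k) N)" for j
    unfolding F_funpow_shift by (simp add: A_def)
  \<comment> \<open>The range \<open>0..n\<close> has \<open>n + 1\<close> equal terms, so the
    prefactor cancels exactly for each \<open>n\<close>.\<close>
  have "1 / (2 * (real n + 1)) * (\<Sum>j=0..n. real_of_int (2 * int ((collatz_T ^^ k) N)))
      = real ((collatz_T ^^ k) N)" for n
    by (simp add: field_simps)
  then show ?thesis
    unfolding summand by simp
qed

end
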